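(* For all positive integers $k$ and $N$, $$f(k,N) \leq \left\lfloor \frac{N \left\lfloor \frac{N}{k} \right\rfloor}{k} \right\rfloor.$$
   Context: Let $k,N$ be positive integers and let $A,B$ be disjoint sets with $|A|=|B|=N$. For $S\subset A\cup B$ write $S_A=S\cap A$ and $S_B=S\cap B$. A family $\mathcal{S}$ of subsets of $A\cup B$ is called semiintersecting (with constants $k$ and $N$) if (i) $|S_A|=|S_B|=k$ for all $S\in\mathcal{S}$, and (ii) for all $S\neq T$ in $\mathcal{S}$, $S_A\cap T_A=\emptyset$ if and only if $S_B\cap T_B\neq\emptyset$. Define $f(k,N)$ to be the maximum of $|\mathcal{S}|$ over all semiintersecting families $\mathcal{S}$ with constants $k$ and $N$. *)

theory Defs
  imports Complex_Main
begin

definition semiintersecting :: "'a set \<Rightarrow> 'a set \<Rightarrow> nat \<Rightarrow> 'a set set \<Rightarrow> bool" where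
  "semiintersecting A B k \<S> \<longleftrightarrow>
     \<S> \<subseteq> Pow (A \<union> B) \<and>
     (\<forall>S\<in>\<S>. card (S \<inter> A) = k \<and> card (S \<inter> B) = k) \<and>
     (\<forall>S\<in>\<S>. \<forall>T\<in>\<S>. S \<noteq> T \<longrightarrow>
        ((S \<inter> A) \<inter> (T \<inter> A) = {} \<longleftrightarrow> (S \<inter> B) \<inter> (T \<inter> B) \<noteq> {}))"

text \<open>The maximum depends on the disjoint ground sets only through their common size \<open>N\<close>
  (see \<open>max_semiintersecting_eq\<close> below, for ground sets in an arbitrary type),
  so it is defined through a fixed choice of them.\<close>

definition max_semiintersecting :: "nat \<Rightarrow> nat \<Rightarrow> nat" where
  "max_semiintersecting k N = Max {card \<S> |\<S>. semiintersecting {..<N} {N..<2*N} k \<S>}"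

lemma semiintersecting_empty: "semiintersecting A B k {}"
  by (simp add: semiintersecting_def)

lemma finite_card_semiintersecting:
  assumes "finite A" "finite B"
  shows "finite {card \<S> |\<S>. semiintersecting A B k \<S>}"
proof -
  have "{card \<S> |\<S>. semiintersecting A B k \<S>} \<subseteq> card ` Pow (Pow (A \<union> B))"
    unfolding semiintersecting_def by blast
  then show ?thesis
    using assms by (meson finite_Pow_iff finite_UnI finite_imageI finite_subset)
qed

lemma semiintersecting_image:
  assumes inj: "inj_on g (A \<union> B)" and S: "semiintersecting A B k \<S>"
  shows "semiintersecting (g ` A) (g ` B) k ((`) g ` \<S>)" "card ((`) g ` \<S>) = card \<S>"
proof -
  have sub: "S \<subseteq> A \<union> B" if "S \<in> \<S>" for S
    using S that unfolding semiintersecting_def by blast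
  have injS: "inj_on ((`) g) \<S>"
    by (rule inj_onI) (use sub inj inj_on_image_eq_iff in metis)
  then show "card ((`) g ` \<S>) = card \<S>" by (rule card_image)
  have int: "g ` S \<inter> g ` C = g ` (S \<inter> C)" if "S \<subseteq> A \<union> B" "C \<subseteq> A \<union> B" for S C
    using inj_on_image_Int[OF inj that] by simp
  have crd: "card (g ` S \<inter> g ` C) = card (S \<inter> C)" if "S \<in> \<S>" "C \<subseteq> A \<union> B" for S C
    using int[OF sub[OF that(1)] that(2)] inj
    by (metis card_image inf.coboundedI2 inj_on_subset that(2))
  have emp: "(g ` S \<inter> g ` C) \<inter> (g ` T \<inter> g ` C) = {} \<longleftrightarrow> (S \<inter> C) \<inter> (T \<inter> C) = {}"
    if "S \<in> \<S>" "T \<in> \<S>" "C \<subseteq> A \<union> B" for S T C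
  proof -
    have "(g ` S \<inter> g ` C) \<inter> (g ` T \<inter> g ` C) = g ` ((S \<inter> C) \<inter> (T \<inter> C))"
      using int[OF sub[OF that(1)] that(3)] int[OF sub[OF that(2)] that(3)]
        int[of "S \<inter> C" "T \<inter> C"] that(3) by auto
    then show ?thesis by simp
  qed
  show "semiintersecting (g ` A) (g ` B) k ((`) g ` \<S>)"
    unfolding semiintersecting_def
  proof (intro conjI ballI impI)
    show "(`) g ` \<S> \<subseteq> Pow (g ` A \<union> g ` B)" using sub by blast
  next
    fix S' assume "S' \<in> (`) g ` \<S>"
    then show "card (S' \<inter> g ` A) = k" "card (S' \<inter> g ` B) = k"
      using S crd[of _ A] crd[of _ B] unfolding semiintersecting_def by auto
  next
    fix S' T' assume "S' \<in> (`) g ` \<S>" "T' \<in> (`) g ` \<S>" "S' \<noteq> T'"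
    then obtain S1 T1 where *: "S1 \<in> \<S>" "T1 \<in> \<S>" "S1 \<noteq> T1" "S' = g ` S1" "T' = g ` T1"
      by blast
    have "(S1 \<inter> A) \<inter> (T1 \<inter> A) = {} \<longleftrightarrow> (S1 \<inter> B) \<inter> (T1 \<inter> B) \<noteq> {}"
      using S *(1-3) unfolding semiintersecting_def by blast
    then show "(S' \<inter> g ` A) \<inter> (T' \<inter> g ` A) = {} \<longleftrightarrow> (S' \<inter> g ` B) \<inter> (T' \<inter> g ` B) \<noteq> {}"
      using emp[OF *(1,2), of A] emp[OF *(1,2), of B] *(4,5) by simp
  qed
qed

lemma card_semiintersecting_subset:
  fixes A B :: "'a set" and A' B' :: "'b set"
  assumes "finite A" "finite B" "A \<inter> B = {}" "finite A'" "finite B'" "A' \<inter> B' = {}"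
    and "card A = card A'" "card B = card B'"
  shows "{card \<S> |\<S>. semiintersecting A B k \<S>} \<subseteq> {card \<S> |\<S>. semiintersecting A' B' k \<S>}"
proof -
  obtain g h where g: "bij_betw g A A'" and h: "bij_betw h B B'"
    using assms finite_same_card_bij by metis
  define u where "u x = (if x \<in> A then g x else h x)" for x
  have uA: "u ` A = A'" and uB: "u ` B = B'" and iA: "inj_on u A" and iB: "inj_on u B"
    using g h assms(3) by (auto simp: u_def bij_betw_def inj_on_def image_def)
  have "inj_on u (A \<union> B)"
    unfolding inj_on_Un using iA iB uA uB assms(6) by blast
  from semiintersecting_image[OF this] show ?thesis
    unfolding uA uB by (smt (verit) mem_Collect_eq subsetI)
qed

lemma max_semiintersecting_eq:
  fixes A B :: "'a set"
  assumes "finite A" "finite B" "A \<inter> B = {}" "card A = N" "card B = N"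
  shows "max_semiintersecting k N = Max {card \<S> |\<S>. semiintersecting A B k \<S>}"
proof -
  have "{..<N} \<inter> {N..<2*N} = {}" by auto
  with assms have "{card \<S> |\<S>. semiintersecting {..<N} {N..<2*N} k \<S>} =
      {card \<S> |\<S>. semiintersecting A B k \<S>}"
    by (intro equalityI card_semiintersecting_subset) auto
  then show ?thesis by (simp add: max_semiintersecting_def)
qed

end

theory Submission
  imports Defs
begin

text \<open>The bound is a double count of the incidences between the points of \<open>A\<close> and the members
  of a semiintersecting family. Two distinct members through a common point of \<open>A\<close> meet inside
  \<open>A\<close>, so they are disjoint inside \<open>B\<close>; the traces on \<open>B\<close> of all members through that point
  therefore pack disjoint \<open>k\<close>-sets into \<open>B\<close>, and the point lies in at most \<open>card B div k\<close>
  members. Each member contains \<open>k\<close> points of \<open>A\<close>, so summing over \<open>A\<close> bounds \<open>k\<close> times the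
  size of the family.\<close>

lemma finite_semiintersecting:
  assumes "finite A" "finite B" "semiintersecting A B k \<S>"
  shows "finite \<S>"
  using assms unfolding semiintersecting_def by (meson finite_Pow_iff finite_UnI finite_subset)

text \<open>The traces on \<open>B\<close> of the members through \<open>a\<close> are pairwise disjoint.\<close>

lemma semiintersecting_degree_le:
  assumes fin: "finite A" "finite B" and S: "semiintersecting A B k \<S>"
    and a: "a \<in> A" and k: "k > 0"
  shows "card {S \<in> \<S>. a \<in> S} \<le> card B div k"
proof -
  let ?D = "{S \<in> \<S>. a \<in> S}"
  have "finite ?D"
    using finite_semiintersecting[OF fin S] by simp
  moreover have "(S \<inter> B) \<inter> (T \<inter> B) = {}" if "S \<in> ?D" "T \<in> ?D" "S \<noteq> T" for S T
    using S that a unfolding semiintersecting_def by blast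
  ultimately have "card (\<Union>S\<in>?D. S \<inter> B) = (\<Sum>S\<in>?D. card (S \<inter> B))"
    using fin by (intro card_UN_disjoint) auto
  also have "\<dots> = card ?D * k"
    using S by (simp add: semiintersecting_def)
  finally have "card ?D * k \<le> card B"
    using card_mono[OF fin(2), of "\<Union>S\<in>?D. S \<inter> B"] by auto
  then show ?thesis
    using k by (simp add: less_eq_div_iff_mult_less_eq)
qed

lemma card_semiintersecting_le:
  assumes fin: "finite A" "finite B" and S: "semiintersecting A B k \<S>" and k: "k > 0"
  shows "card \<S> \<le> card A * (card B div k) div k"
proof -
  have "card \<S> * k = (\<Sum>S\<in>\<S>. card {a \<in> A. a \<in> S})"
    using S by (simp add: semiintersecting_def Int_def conj_commute)
  also have "\<dots> = (\<Sum>a\<in>A. card {S \<in> \<S>. a \<in> S})"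
    by (rule sum_multicount_gen) (use fin finite_semiintersecting[OF fin S] in auto)
  also have "\<dots> \<le> card A * (card B div k)"
    using sum_bounded_above[of A "\<lambda>a. card {S \<in> \<S>. a \<in> S}" "card B div k"]
      semiintersecting_degree_le[OF fin S _ k] by simp
  finally show ?thesis
    using k by (simp add: less_eq_div_iff_mult_less_eq)
qed

theorem lemma2p2:
  fixes k N :: nat
  assumes "k > 0" and "N > 0"
  shows "int (max_semiintersecting k N) \<le> \<lfloor>real N * of_int \<lfloor>real N / real k\<rfloor> / real k\<rfloor>"
proof -
  let ?C = "{card \<S> |\<S>. semiintersecting {..<N} {N..<2*N} k \<S>}"
  have "finite ?C"
    by (rule finite_card_semiintersecting) auto
  moreover have "?C \<noteq> {}"
    using semiintersecting_empty by blast
  moreover have "c \<le> N * (N div k) div k" if "c \<in> ?C" for c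
    using that card_semiintersecting_le[of "{..<N}" "{N..<2*N}" k] assms(1) by auto
  ultimately have "max_semiintersecting k N \<le> N * (N div k) div k"
    unfolding max_semiintersecting_def by simp
  moreover have "\<lfloor>real N * of_int \<lfloor>real N / real k\<rfloor> / real k\<rfloor> = int (N * (N div k) div k)"
    using floor_divide_of_nat_eq[of "N * (N div k)" k, where 'a = real]
    by (simp add: floor_divide_of_nat_eq)
  ultimately show ?thesis by simp
qed

end
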